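(* Let $I\subseteq R=k[x_1,\ldots,x_n]$ be a nonzero proper squarefree monomial ideal with minimal primary decomposition $I=P_1\cap P_2\cap\cdots\cap P_s$, where each $P_j=\langle x_{j_1},\ldots,x_{j_{s_j}}\rangle$ is generated by a subset of the variables. Let $A$ be the $s\times n$ matrix with $$A_{i,j}=\begin{cases}1 & \text{if } x_j\in P_i,\\ 0&\text{if } x_j\notin P_i.\end{cases}$$ Consider the linear program: minimize $\mathbf 1^T\mathbf y$ subject to $A\mathbf y\ge\mathbf 1$ and $\mathbf y\ge\mathbf 0$ ($\mathbf y\in\mathbb R^n$), and suppose that $\mathbf y^*$ is a feasible solution that realizes the optimal value. Then $$\widehat\alpha(I)=\mathbf 1^T\mathbf y^*.$$ That is, $\widehat\alpha(I)$ is the value of this linear program.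
   Context: $k$ is an algebraically closed field of any characteristic. Vector inequalities are coordinatewise; $\mathbf 1$ and $\mathbf 0$ denote vectors of all ones and all zeros of the appropriate size. A squarefree monomial ideal is an ideal generated by squarefree monomials. For a nonzero homogeneous ideal $J\subseteq R$: $\alpha(J)=\min\{d\mid J_d\neq 0\}$ is the smallest degree of a nonzero element of $J$; the $m$-th symbolic power is $J^{(m)}=\bigcap_{P\in \mathrm{Ass}(J)}(J^mR_P\cap R)$; the Waldschmidt constant is $\widehat\alpha(J)=\lim_{m\to\infty}\alpha(J^{(m)})/m$ (the limit exists). *)

theory Defs
  imports
    "HOL-Analysis.Analysis"
    "HOL-Algebra.Algebraic_Closure_Type"
    "HOL-Algebra.Ideal_Product"
    "HOL-Library.Poly_Mapping"
    "HOL-Computational_Algebra.Fraction_Field"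
begin

text \<open>
  The polynomial ring in the variables indexed by \<open>'n\<close> is the type
  \<open>('n \<Rightarrow>\<^sub>0 nat) \<Rightarrow>\<^sub>0 'k\<close> (finitely supported coefficients, indexed by exponent vectors).
  The order on \<open>'n\<close> is used only to obtain that this type is an integral domain.
  Ideals are those of HOL-Algebra, for the ring record \<open>ring_of_type_algebra\<close>
  whose carrier is the whole type.
\<close>

type_synonym ('n, 'k) mpoly = "('n \<Rightarrow>\<^sub>0 nat) \<Rightarrow>\<^sub>0 'k"

definition monom_of :: "('n \<Rightarrow>\<^sub>0 nat) \<Rightarrow> ('n, 'k::comm_ring_1) mpoly"
  where "monom_of e = Poly_Mapping.single e 1"

definition var :: "'n \<Rightarrow> ('n, 'k::comm_ring_1) mpoly"
  where "var i = monom_of (Poly_Mapping.single i 1)"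

definition squarefree_monomial_ideal :: "('n, 'k::comm_ring_1) mpoly set \<Rightarrow> bool"
  where "squarefree_monomial_ideal J \<longleftrightarrow>
    (\<exists>E. (\<forall>e\<in>E. \<forall>i. Poly_Mapping.lookup e i \<le> 1)
         \<and> J = Idl\<^bsub>ring_of_type_algebra\<^esub> (monom_of ` E))"

definition monom_degree :: "('n::finite \<Rightarrow>\<^sub>0 nat) \<Rightarrow> nat"
  where "monom_degree e = (\<Sum>i\<in>UNIV. Poly_Mapping.lookup e i)"

definition graded_piece :: "('n::finite, 'k::comm_ring_1) mpoly set \<Rightarrow> nat \<Rightarrow> ('n, 'k) mpoly set"
  where "graded_piece J d = {f \<in> J. \<forall>e \<in> Poly_Mapping.keys f. monom_degree e = d}"

definition initial_degree :: "('n::finite, 'k::comm_ring_1) mpoly set \<Rightarrow> nat"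
  where "initial_degree J = (LEAST d. graded_piece J d \<noteq> {0})"


definition radical :: "'a::comm_ring_1 set \<Rightarrow> 'a set"
  where "radical J = {a. \<exists>n. a ^ n \<in> J}"

definition primary_ideal :: "'a::comm_ring_1 set \<Rightarrow> bool"
  where "primary_ideal Q \<longleftrightarrow> ideal Q ring_of_type_algebra \<and> Q \<noteq> UNIV
    \<and> (\<forall>a b. a * b \<in> Q \<longrightarrow> a \<in> Q \<or> b \<in> radical Q)"

definition minimal_primary_decomposition :: "'a::comm_ring_1 set \<Rightarrow> ('s \<Rightarrow> 'a set) \<Rightarrow> bool"
  where "minimal_primary_decomposition J Q \<longleftrightarrow>
    (\<forall>j. primary_ideal (Q j)) \<and> J = (\<Inter>j. Q j)
    \<and> inj (\<lambda>j. radical (Q j)) \<and> (\<forall>j. \<not> (\<Inter>i\<in>-{j}. Q i) \<subseteq> Q j)"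

text \<open>\<open>Ass J\<close> is the usual \<open>Ass(R/J)\<close>: the prime ideals that are annihilators of a
  residue class \<open>f + J\<close>.\<close>

definition Ass :: "'a::comm_ring_1 set \<Rightarrow> 'a set set"
  where "Ass J = {P. primeideal P ring_of_type_algebra \<and> (\<exists>f. P = {g. g * f \<in> J})}"

text \<open>\<open>localization_at P\<close> is \<open>R\<^sub>P\<close>, realized as a subring of the fraction field of the
  domain \<open>R\<close>; if \<open>P\<close> is prime then \<open>b \<notin> P\<close> implies \<open>b \<noteq> 0\<close>.\<close>

definition localization_at :: "'a::idom set \<Rightarrow> 'a fract ring"
  where "localization_at P = ring_of_type_algebra \<lparr>carrier := {Fract a b | a b. b \<notin> P}\<rparr>"

definition extend_contract :: "'a::idom set \<Rightarrow> 'a set \<Rightarrow> 'a set"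
  where "extend_contract P J =
    {f. Fract f 1 \<in> Idl\<^bsub>localization_at P\<^esub> ((\<lambda>g. Fract g 1) ` J)}"

definition symbolic_power :: "'a::idom set \<Rightarrow> nat \<Rightarrow> 'a set"
  where "symbolic_power J m =
    (\<Inter>P\<in>Ass J. extend_contract P (J [^]\<^bsub>ideals_set ring_of_type_algebra\<^esub> m))"

definition waldschmidt_seq :: "('n::{finite,linorder}, 'k::field) mpoly set \<Rightarrow> nat \<Rightarrow> real"
  where "waldschmidt_seq J m = real (initial_degree (symbolic_power J m)) / real m"

definition waldschmidt_constant :: "('n::{finite,linorder}, 'k::field) mpoly set \<Rightarrow> real"
  where "waldschmidt_constant J = lim (waldschmidt_seq J)"


text \<open>The order on \<^typ>\<open>real ^ 'n\<close> is coordinatewise, and \<open>1\<close> is the all-ones vector.\<close>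

definition lp_feasible :: "real ^ 'n ^ 's \<Rightarrow> (real ^ 'n) set"
  where "lp_feasible A = {y. A *v y \<ge> 1 \<and> y \<ge> 0}"

definition lp_value :: "real ^ 'n ^ 's \<Rightarrow> real"
  where "lp_value A = (INF y\<in>lp_feasible A. 1 \<bullet> y)"

definition incidence_matrix ::
  "('s \<Rightarrow> ('n, 'k::comm_ring_1) mpoly set) \<Rightarrow> real ^ 'n ^ 's"
  where "incidence_matrix P = (\<chi> i j. if var j \<in> P i then 1 else 0)"

end

theory Submission
  imports Defs
begin

text \<open>
  Write \<open>P\<^sub>j\<close> as the ideal of the variables in \<open>S\<^sub>j\<close>. Its order filtration consists of the polynomials
  all of whose monomials have degree at least \<open>m\<close> in the variables of \<open>S\<^sub>j\<close>. The associated primes of \<open>I\<close>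
  are the \<open>P\<^sub>j\<close>, and extending \<open>I\<^sup>m\<close> to the localization at \<open>P\<^sub>j\<close> and contracting gives exactly the \<open>m\<close>-th
  step of this filtration: products of lowest forms do not vanish, so elements outside \<open>P\<^sub>j\<close> cannot
  raise the order, while \<open>g\<^sup>m P\<^sub>j\<^sup>m \<subseteq> I\<^sup>m\<close> for any \<open>g\<close> lying in all \<open>P\<^sub>i\<close> but \<open>P\<^sub>j\<close>. Hence the initial degree
  of the \<open>m\<close>-th symbolic power is the least \<open>|e|\<close> over integer vectors \<open>e \<ge> 0\<close> with \<open>A e \<ge> m\<close>.
  Then \<open>e/m\<close> is feasible for the linear program; conversely, rounding \<open>m y\<^sup>*\<close> up loses at most \<open>n\<close>,
  which is negligible after division by \<open>m\<close>.
\<close>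

subsection \<open>Ideals of a type-class ring\<close>

lemma ring_of_type_algebra_sel [simp]:
  "carrier ring_of_type_algebra = UNIV"
  "a \<otimes>\<^bsub>ring_of_type_algebra\<^esub> b = a * b"
  "a \<oplus>\<^bsub>ring_of_type_algebra\<^esub> b = a + b"
  "\<one>\<^bsub>ring_of_type_algebra\<^esub> = 1"
  "\<zero>\<^bsub>ring_of_type_algebra\<^esub> = 0"
  by (simp_all add: ring_of_type_algebra_def)

lemma ring_of_type_algebra_uminus [simp]:
  "\<ominus>\<^bsub>ring_of_type_algebra\<^esub> (a :: 'a::comm_ring_1) = - a"
proof -
  interpret ring "ring_of_type_algebra :: 'a ring" ..
  show ?thesis by (rule minus_equality) auto
qed

lemma ideal_ring_of_type_algebra_iff:
  fixes J :: "'a::comm_ring_1 set"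
  shows "ideal J ring_of_type_algebra \<longleftrightarrow>
    0 \<in> J \<and> (\<forall>a\<in>J. \<forall>b\<in>J. a + b \<in> J) \<and> (\<forall>a\<in>J. \<forall>x. x * a \<in> J)"
proof
  assume "ideal J ring_of_type_algebra"
  then interpret ideal J "ring_of_type_algebra :: 'a ring" .
  show "0 \<in> J \<and> (\<forall>a\<in>J. \<forall>b\<in>J. a + b \<in> J) \<and> (\<forall>a\<in>J. \<forall>x. x * a \<in> J)"
    using additive_subgroup.zero_closed[OF additive_subgroup_axioms]
      additive_subgroup.a_closed[OF additive_subgroup_axioms] I_l_closed by auto
next
  interpret R: ring "ring_of_type_algebra :: 'a ring" ..
  assume *: "0 \<in> J \<and> (\<forall>a\<in>J. \<forall>b\<in>J. a + b \<in> J) \<and> (\<forall>a\<in>J. \<forall>x. x * a \<in> J)"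
  show "ideal J ring_of_type_algebra"
  proof (rule idealI)
    have "- a \<in> J" if "a \<in> J" for a
      using * that by (metis mult_minus1)
    then show "subgroup J (add_monoid (ring_of_type_algebra :: 'a ring))"
      using * by (intro R.add.subgroupI) (auto simp: a_inv_def[symmetric])
  qed (use * R.ring_axioms in \<open>auto simp: mult.commute\<close>)
qed

context
  fixes J :: "'a::comm_ring_1 set"
  assumes J: "ideal J ring_of_type_algebra"
begin

lemma ideal_zero: "0 \<in> J"
  and ideal_add: "a \<in> J \<Longrightarrow> b \<in> J \<Longrightarrow> a + b \<in> J"
  and ideal_mult_left: "a \<in> J \<Longrightarrow> x * a \<in> J"
  and ideal_mult_right: "a \<in> J \<Longrightarrow> a * x \<in> J"
  using J by (auto simp: ideal_ring_of_type_algebra_iff mult.commute)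

lemma ideal_diff: "a \<in> J \<Longrightarrow> b \<in> J \<Longrightarrow> a - b \<in> J"
  using ideal_add[of a "- 1 * b"] ideal_mult_left by fastforce

lemma ideal_sum: "(\<And>x. x \<in> Y \<Longrightarrow> f x \<in> J) \<Longrightarrow> (\<Sum>x\<in>Y. f x) \<in> J"
  by (induction Y rule: infinite_finite_induct) (auto intro: ideal_zero ideal_add)

end

lemma ideal_power:
  fixes J :: "'a::comm_ring_1 set"
  assumes "ideal J ring_of_type_algebra"
  shows "ideal (J [^]\<^bsub>ideals_set ring_of_type_algebra\<^esub> (m::nat)) ring_of_type_algebra"
proof -
  interpret ring "ring_of_type_algebra :: 'a ring" ..
  show ?thesis
    by (induction m) (use assms oneideal in \<open>auto simp: nat_pow_def ideals_set_def ideal_prod_is_ideal\<close>)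
qed

text \<open>The product ideal is generated additively by products, so an induction on
  \<open>m\<close> only has to treat a single product and a sum. It is applied to the order
  filtration, with \<open>F m = order_ideal S m\<close>.\<close>

lemma ideal_power_subset:
  fixes J :: "'a::comm_ring_1 set" and F :: "nat \<Rightarrow> 'a set"
  assumes "J \<subseteq> F 1" and "F 0 = UNIV" and "\<And>m. ideal (F m) ring_of_type_algebra"
    and "\<And>m f g. f \<in> F m \<Longrightarrow> g \<in> F 1 \<Longrightarrow> f * g \<in> F (Suc m)"
  shows "J [^]\<^bsub>ideals_set ring_of_type_algebra\<^esub> (m::nat) \<subseteq> F m"
proof (induction m)
  case (Suc m)
  have "f \<in> F (Suc m)"
    if "f \<in> ideal_prod ring_of_type_algebra (J [^]\<^bsub>ideals_set ring_of_type_algebra\<^esub> m) J" for f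
    using that
  proof induction
    case (prod i j)
    then show ?case using Suc assms(1) assms(4)[of i m j] by auto
  next
    case (sum s1 s2)
    then show ?case by (simp add: ideal_add[OF assms(3)])
  qed
  then show ?case by (auto simp: nat_pow_def ideals_set_def)
qed (use assms in auto)

lemma mult_mem_ideal_power_Suc:
  assumes "f \<in> J [^]\<^bsub>ideals_set ring_of_type_algebra\<^esub> (m::nat)" and "g \<in> J"
  shows "f * g \<in> J [^]\<^bsub>ideals_set ring_of_type_algebra\<^esub> (Suc m)"
  using ideal_prod.prod[of f _ g J ring_of_type_algebra] assms
  by (simp add: nat_pow_def ideals_set_def)

section \<open>Primes, and the associated primes of an irredundant intersection\<close>

lemma primeideal_ring_of_type_algebra_iff:
  fixes P :: "'a::comm_ring_1 set"
  shows "primeideal P ring_of_type_algebra \<longleftrightarrow>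
    ideal P ring_of_type_algebra \<and> 1 \<notin> P \<and> (\<forall>a b. a * b \<in> P \<longrightarrow> a \<in> P \<or> b \<in> P)"
proof
  assume "primeideal P ring_of_type_algebra"
  then interpret primeideal P "ring_of_type_algebra :: 'a ring" .
  have "1 \<notin> P" using I_notcarr one_imp_carrier by auto
  then show "ideal P ring_of_type_algebra \<and> 1 \<notin> P \<and> (\<forall>a b. a * b \<in> P \<longrightarrow> a \<in> P \<or> b \<in> P)"
    using is_ideal I_prime by auto
qed (intro primeidealI, auto)

text \<open>Prime avoidance by products: if every \<open>Q j\<close> had an element outside
  \<open>P\<close>, the product of these elements would lie in the intersection, hence in
  \<open>P\<close>, against primality.\<close>

lemma prime_Inter_eq:
  fixes P :: "'a::comm_ring_1 set"
  assumes P: "primeideal P ring_of_type_algebra" and "finite Y"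
    and "\<And>j. j \<in> Y \<Longrightarrow> ideal (Q j) ring_of_type_algebra"
    and eq: "P = (\<Inter>j\<in>Y. Q j)"
  obtains j where "j \<in> Y" "P = Q j"
proof -
  \<comment> \<open>The base case uses \<open>1 \<notin> P\<close>, which also rules out an empty
    \<open>Y\<close>.\<close>
  have prod: "prod h Y \<in> P \<Longrightarrow> \<exists>j\<in>Y. h j \<in> P" for h
    using \<open>finite Y\<close> P
    by (induction Y rule: finite_induct) (auto simp: primeideal_ring_of_type_algebra_iff)
  have "\<exists>j\<in>Y. Q j \<subseteq> P"
  proof (rule ccontr)
    assume "\<not> (\<exists>j\<in>Y. Q j \<subseteq> P)"
    then have "\<forall>j\<in>Y. \<exists>x. x \<in> Q j \<and> x \<notin> P" by blast
    from bchoice[OF this]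
    obtain h where h: "\<And>j. j \<in> Y \<Longrightarrow> h j \<in> Q j \<and> h j \<notin> P" by blast
    have "prod h Y \<in> Q j" if "j \<in> Y" for j
      using that h assms(2,3) by (simp add: prod.remove ideal_mult_right)
    then have "prod h Y \<in> P" using eq by blast
    then show False using prod h by blast
  qed
  then show thesis using that eq by blast
qed

text \<open>The annihilator of the class of \<open>f\<close> is the intersection of those
  \<open>P j\<close> that miss \<open>f\<close>. If it is prime, it is one of them. Conversely,
  irredundance supplies an \<open>f\<close> missed by one chosen \<open>P j\<close> only.\<close>

lemma Ass_Inter_primes:
  fixes P :: "'s::finite \<Rightarrow> 'a::comm_ring_1 set"
  assumes prime: "\<And>j. primeideal (P j) ring_of_type_algebra"
    and irr: "\<And>j. \<not> (\<Inter>i\<in>-{j}. P i) \<subseteq> P j"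
  shows "Ass (\<Inter>j. P j) = range P"
proof
  have ideal: "ideal (P j) ring_of_type_algebra" for j
    using prime by (simp add: primeideal_ring_of_type_algebra_iff)
  have "g * f \<in> P j \<longleftrightarrow> f \<in> P j \<or> g \<in> P j" for f g j
    using prime[of j] ideal_mult_left[OF ideal] ideal_mult_right[OF ideal]
    by (auto simp: primeideal_ring_of_type_algebra_iff)
  then have colon: "{g. g * f \<in> (\<Inter>j. P j)} = (\<Inter>j\<in>{j. f \<notin> P j}. P j)" for f
    by auto
  show "Ass (\<Inter>j. P j) \<subseteq> range P"
  proof
    fix Q assume "Q \<in> Ass (\<Inter>j. P j)"
    then obtain f where "primeideal Q ring_of_type_algebra" "Q = (\<Inter>j\<in>{j. f \<notin> P j}. P j)"
      unfolding Ass_def colon by blast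
    then obtain j where "Q = P j"
      by (rule prime_Inter_eq[OF _ finite ideal])
    then show "Q \<in> range P" by simp
  qed
  show "range P \<subseteq> Ass (\<Inter>j. P j)"
  proof
    fix Q assume "Q \<in> range P"
    then obtain j where j: "Q = P j" by auto
    obtain f where f: "f \<in> (\<Inter>i\<in>-{j}. P i)" "f \<notin> P j" using irr by blast
    then have "{j. f \<notin> P j} = {j}" by auto
    with colon[of f] have "P j = {g. g * f \<in> (\<Inter>j. P j)}" by simp
    then show "Q \<in> Ass (\<Inter>j. P j)" using prime j unfolding Ass_def by blast
  qed
qed

subsection \<open>Extension to and contraction from a localization\<close>

lemma localization_at_ring:
  fixes P :: "'a::idom set"
  assumes "primeideal P ring_of_type_algebra"
  shows "ring (localization_at P)"
proof -
  interpret F: ring "ring_of_type_algebra :: 'a fract ring" ..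
  have P: "0 \<in> P" "1 \<notin> P" "a \<notin> P \<Longrightarrow> b \<notin> P \<Longrightarrow> a * b \<notin> P" for a b
    using assms ideal_zero by (auto simp: primeideal_ring_of_type_algebra_iff)
  have "subring {Fract a b | a b. b \<notin> P} (ring_of_type_algebra :: 'a fract ring)"
  proof (rule F.subringI; (elim CollectE exE conjE)?)
    show "\<one>\<^bsub>ring_of_type_algebra\<^esub> \<in> {Fract a b | a b. b \<notin> P}"
      using P(2) by (auto simp: One_fract_def)
  next
    fix h :: "'a fract" and a b assume "h = Fract a b" "b \<notin> P"
    then show "\<ominus>\<^bsub>ring_of_type_algebra\<^esub> h \<in> {Fract a b | a b. b \<notin> P}" by auto
  next
    fix h h' :: "'a fract" and a b a' b'
    assume h: "h = Fract a b" "b \<notin> P" "h' = Fract a' b'" "b' \<notin> P"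
    then have "b \<noteq> 0" "b' \<noteq> 0" using P(1) by auto
    with h P(3)[of b b'] show "h \<otimes>\<^bsub>ring_of_type_algebra\<^esub> h' \<in> {Fract a b | a b. b \<notin> P}"
      "h \<oplus>\<^bsub>ring_of_type_algebra\<^esub> h' \<in> {Fract a b | a b. b \<notin> P}" by auto
  qed auto
  then show ?thesis unfolding localization_at_def by (rule F.subring_is_ring)
qed

text \<open>These fractions make up the extension of \<open>J\<close> to the localization. That they
  form an ideal bounds the generated ideal from above in \<open>extend_contract_eq\<close>.\<close>

lemma localization_at_ideal:
  fixes P :: "'a::idom set"
  assumes P: "primeideal P ring_of_type_algebra" and J: "ideal J ring_of_type_algebra"
  shows "ideal {Fract a b | a b. a \<in> J \<and> b \<notin> P} (localization_at P)" (is "ideal ?K ?L")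
proof -
  interpret L: ring ?L by (rule localization_at_ring[OF P])
  have P': "0 \<in> P" "1 \<notin> P" "a \<notin> P \<Longrightarrow> b \<notin> P \<Longrightarrow> a * b \<notin> P" for a b
    using P ideal_zero by (auto simp: primeideal_ring_of_type_algebra_iff)
  have sel: "carrier ?L = {Fract a b | a b. b \<notin> P}" "x \<otimes>\<^bsub>?L\<^esub> y = x * y" "x \<oplus>\<^bsub>?L\<^esub> y = x + y"
    "\<zero>\<^bsub>?L\<^esub> = 0" for x y
    by (simp_all add: localization_at_def)
  have mult: "x * y \<in> ?K" if x: "x \<in> ?K" and y: "y \<in> carrier ?L" for x y
  proof -
    obtain a b where "x = Fract a b" "a \<in> J" "b \<notin> P" using x by auto
    moreover obtain c d where "y = Fract c d" "d \<notin> P" using y by (auto simp: sel)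
    ultimately show ?thesis using P'(3)[of b d] ideal_mult_right[OF J, of a c] by auto
  qed
  have add: "x + y \<in> ?K" if x: "x \<in> ?K" and y: "y \<in> ?K" for x y
  proof -
    obtain a b where xx: "x = Fract a b" "a \<in> J" "b \<notin> P" using x by auto
    obtain c d where yy: "y = Fract c d" "c \<in> J" "d \<notin> P" using y by auto
    have "b \<noteq> 0" "d \<noteq> 0" using P'(1) xx yy by auto
    then have "x + y = Fract (a * d + c * b) (b * d)" using xx yy by simp
    moreover have "a * d + c * b \<in> J"
      using xx yy by (simp add: ideal_add[OF J] ideal_mult_right[OF J])
    ultimately show ?thesis using P'(3)[of b d] xx yy by auto
  qed
  have zero: "0 \<in> ?K" using P'(2) ideal_zero[OF J] by (auto simp: Zero_fract_def)
  have sub: "?K \<subseteq> carrier ?L" by (auto simp: sel)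
  show ?thesis
  proof (rule idealI)
    show "subgroup ?K (add_monoid ?L)"
    proof (rule L.add.subgroupI)
      fix x assume x: "x \<in> ?K"
      then have "x \<in> carrier ?L" using sub by blast
      \<comment> \<open>Writing the inverse as a product with minus one reduces closure under
        negation to \<open>mult\<close>.\<close>
      then have "\<ominus>\<^bsub>?L\<^esub> x = x \<otimes>\<^bsub>?L\<^esub> (\<ominus>\<^bsub>?L\<^esub> \<one>\<^bsub>?L\<^esub>)"
        by (simp add: L.r_minus)
      also have "\<dots> = x * (\<ominus>\<^bsub>?L\<^esub> \<one>\<^bsub>?L\<^esub>)" by (simp add: sel)
      also have "\<dots> \<in> ?K" by (rule mult[OF x]) simp
      finally show "\<ominus>\<^bsub>?L\<^esub> x \<in> ?K" .
    next
      show "?K \<noteq> {}" using zero by blast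
      show "x \<oplus>\<^bsub>?L\<^esub> y \<in> ?K" if "x \<in> ?K" "y \<in> ?K" for x y
        using add[OF that] by (simp add: sel)
    qed (use sub in simp)
    show "x \<otimes>\<^bsub>?L\<^esub> a \<in> ?K" "a \<otimes>\<^bsub>?L\<^esub> x \<in> ?K" if "a \<in> ?K" "x \<in> carrier ?L" for a x
      using mult[OF that] by (simp_all only: sel mult.commute)
  qed (rule L.ring_axioms)
qed

text \<open>Contracting the extension saturates \<open>J\<close> by the complement of
  \<open>P\<close>. If \<open>f/1 = a/b\<close>, cross-multiplying gives \<open>f * b = a\<close>;
  conversely \<open>f/1\<close> is \<open>1/b\<close> times \<open>(f * b)/1\<close>.\<close>

lemma extend_contract_eq:
  fixes P :: "'a::idom set"
  assumes P: "primeideal P ring_of_type_algebra" and J: "ideal J ring_of_type_algebra"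
  shows "extend_contract P J = {f. \<exists>b. b \<notin> P \<and> f * b \<in> J}"
proof -
  have P': "0 \<in> P" "1 \<notin> P"
    using P ideal_zero by (auto simp: primeideal_ring_of_type_algebra_iff)
  let ?K = "{Fract a b | a b. a \<in> J \<and> b \<notin> P}"
  have "\<exists>b. b \<notin> P \<and> f * b \<in> J"
    if f: "Fract f 1 \<in> Idl\<^bsub>localization_at P\<^esub> ((\<lambda>g. Fract g 1) ` J)" for f
  proof -
    have "(\<lambda>g. Fract g 1) ` J \<subseteq> ?K" using P'(2) by auto
    with f localization_at_ideal[OF P J] have "Fract f 1 \<in> ?K"
      unfolding genideal_def by blast
    then obtain a b where ab: "Fract f 1 = Fract a b" "a \<in> J" "b \<notin> P" by auto
    then have "b \<noteq> 0" using P'(1) by auto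
    with ab show ?thesis by (auto simp: eq_fract)
  qed
  moreover have "Fract f 1 \<in> Idl\<^bsub>localization_at P\<^esub> ((\<lambda>g. Fract g 1) ` J)"
    if fb: "b \<notin> P" "f * b \<in> J" for f b
    unfolding genideal_def
  proof (intro InterI, elim CollectE conjE)
    fix K assume K: "ideal K (localization_at P)" "(\<lambda>g. Fract g 1) ` J \<subseteq> K"
    interpret ideal K "localization_at P" by fact
    have "Fract 1 b \<otimes>\<^bsub>localization_at P\<^esub> Fract (f * b) 1 \<in> K"
      using K(2) fb by (intro I_l_closed) (auto simp: localization_at_def)
    moreover have "b \<noteq> 0" using fb P'(1) by auto
    ultimately show "Fract f 1 \<in> K"
      using mult_fract_cancel[of b f 1] by (simp add: localization_at_def mult.commute)
  qed
  ultimately show ?thesis unfolding extend_contract_def by blast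
qed

subsection \<open>The order of a polynomial along a set of variables\<close>

definition degree_on :: "'n::finite set \<Rightarrow> ('n \<Rightarrow>\<^sub>0 nat) \<Rightarrow> nat"
  where "degree_on S e = (\<Sum>i\<in>S. Poly_Mapping.lookup e i)"

text \<open>This is the \<open>m\<close>-th power of the ideal generated by the variables in
  \<open>S\<close>, described through exponents so that membership is a condition on each monomial
  separately.\<close>

definition order_ideal :: "'n::finite set \<Rightarrow> nat \<Rightarrow> ('n, 'k::comm_ring_1) mpoly set"
  where "order_ideal S m = {f. \<forall>e\<in>Poly_Mapping.keys f. m \<le> degree_on S e}"

lemma degree_on_add: "degree_on S (e + e') = degree_on S e + degree_on S e'"
  by (simp add: degree_on_def lookup_add sum.distrib)

lemma order_ideal_mult:
  assumes "f \<in> order_ideal S m" and "g \<in> order_ideal S m'"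
  shows "f * g \<in> order_ideal S (m + m')"
  using assms keys_mult[of f g] by (fastforce simp: order_ideal_def degree_on_add intro: add_mono)

lemma order_ideal_0 [simp]: "order_ideal S 0 = UNIV"
  by (simp add: order_ideal_def)

lemma ideal_order_ideal: "ideal (order_ideal S m) ring_of_type_algebra"
  unfolding ideal_ring_of_type_algebra_iff
proof (intro conjI ballI allI)
  show "f + g \<in> order_ideal S m" if "f \<in> order_ideal S m" "g \<in> order_ideal S m"
    for f g :: "('a, 'b) mpoly"
    using that Poly_Mapping.keys_add[of f g] by (fastforce simp: order_ideal_def)
  show "x * f \<in> order_ideal S m" if "f \<in> order_ideal S m" for f x :: "('a, 'b) mpoly"
    using order_ideal_mult[of x S 0 f m] that by simp
qed (simp add: order_ideal_def)

lemma sum_single_keys: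
  fixes f :: "'b \<Rightarrow>\<^sub>0 'c::comm_monoid_add"
  shows "(\<Sum>k\<in>Poly_Mapping.keys f. Poly_Mapping.single k (Poly_Mapping.lookup f k)) = f"
  by (rule poly_mapping_eqI)
    (auto simp: lookup_sum lookup_single when_def not_in_keys_iff_lookup_eq_zero)

lemma lowest_form:
  assumes "f \<notin> order_ideal S m"
  obtains d f0 f1 where "d < m" "f = f0 + f1" "f0 \<noteq> 0" "f0 \<in> order_ideal S d" "f1 \<in> order_ideal S (Suc d)"
    "\<And>e. e \<in> Poly_Mapping.keys f0 \<Longrightarrow> degree_on S e = d"
proof -
  obtain e where e: "e \<in> Poly_Mapping.keys f" "degree_on S e < m"
    using assms by (auto simp: order_ideal_def not_le)
  \<comment> \<open>\<open>d\<close> is the order of \<open>f\<close> along \<open>S\<close>;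
    \<open>Y\<close> below collects the monomials that attain it.\<close>
  define d where "d = (LEAST d. \<exists>e\<in>Poly_Mapping.keys f. degree_on S e = d)"
  have "\<exists>e\<in>Poly_Mapping.keys f. degree_on S e = d"
    unfolding d_def by (rule LeastI_ex) (use e in auto)
  then obtain e0 where e0: "e0 \<in> Poly_Mapping.keys f" "degree_on S e0 = d" by auto
  have min: "d \<le> degree_on S e'" if "e' \<in> Poly_Mapping.keys f" for e'
    unfolding d_def using that by (intro Least_le) auto
  define part where "part Y = (\<Sum>k\<in>Y. Poly_Mapping.single k (Poly_Mapping.lookup f k))" for Y
  define Y where "Y = {k \<in> Poly_Mapping.keys f. degree_on S k = d}"
  have lookup_part: "Poly_Mapping.lookup (part Z) k = (if k \<in> Z then Poly_Mapping.lookup f k else 0)"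
    if "finite Z" for Z k
    using that by (simp add: part_def lookup_sum lookup_single when_def)
  have fin: "finite Y" "finite (Poly_Mapping.keys f - Y)" by (auto simp: Y_def)
  have keys_part: "e \<in> Poly_Mapping.keys (part Y) \<Longrightarrow> degree_on S e = d" for e
    using lookup_part[OF fin(1), of e] by (auto simp: in_keys_iff Y_def split: if_splits)
  show thesis
  proof (rule that[of d "part Y" "part (Poly_Mapping.keys f - Y)"])
    show "d < m" using min[OF e(1)] e(2) by simp
    show "f = part Y + part (Poly_Mapping.keys f - Y)"
      by (rule poly_mapping_eqI)
        (auto simp: lookup_add lookup_part fin Y_def not_in_keys_iff_lookup_eq_zero)
    have "e0 \<in> Y" using e0 by (simp add: Y_def)
    then have "Poly_Mapping.lookup (part Y) e0 \<noteq> 0"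
      using e0 lookup_part[OF fin(1), of e0] by (simp add: in_keys_iff)
    then show "part Y \<noteq> 0" by auto
    show "part Y \<in> order_ideal S d" using keys_part by (auto simp: order_ideal_def)
    have "Suc d \<le> degree_on S e" if "e \<in> Poly_Mapping.keys (part (Poly_Mapping.keys f - Y))" for e
    proof -
      have "e \<in> Poly_Mapping.keys f - Y"
        using that lookup_part[OF fin(2), of e] by (auto simp: in_keys_iff split: if_splits)
      then show ?thesis using min[of e] by (auto simp: Y_def)
    qed
    then show "part (Poly_Mapping.keys f - Y) \<in> order_ideal S (Suc d)"
      by (simp add: order_ideal_def)
  qed (rule keys_part)
qed

text \<open>The order along \<open>S\<close> behaves like a valuation. The lowest form of
  \<open>f\<close> times that of \<open>b\<close> is nonzero in a domain and keeps the degree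
  \<open>d\<close> of the former, so \<open>f * b\<close> cannot have order above
  \<open>d\<close>.\<close>

lemma order_ideal_cancel:
  fixes f b :: "('n::{finite,linorder}, 'k::idom) mpoly"
  assumes fb: "f * b \<in> order_ideal S m" and b: "b \<notin> order_ideal S 1"
  shows "f \<in> order_ideal S m"
proof (rule ccontr)
  note diff = ideal_diff[OF ideal_order_ideal]
  assume "f \<notin> order_ideal S m"
  then obtain d f0 f1 where f: "d < m" "f = f0 + f1" "f0 \<noteq> 0" "f0 \<in> order_ideal S d"
    "f1 \<in> order_ideal S (Suc d)" "\<And>e. e \<in> Poly_Mapping.keys f0 \<Longrightarrow> degree_on S e = d"
    by (rule lowest_form) blast
  \<comment> \<open>The bound \<open>d < 1\<close> from \<open>lowest_form\<close> forces degree 0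
    for \<open>b0\<close>.\<close>
  obtain b0 b1 where b01: "b = b0 + b1" "b0 \<noteq> 0" "b1 \<in> order_ideal S 1"
    "\<And>e. e \<in> Poly_Mapping.keys b0 \<Longrightarrow> degree_on S e = 0"
    using b by (rule lowest_form) auto
  \<comment> \<open>Each term on the right has order at least \<open>Suc d\<close>, the first one
    because \<open>d < m\<close>.\<close>
  have "f0 * b0 = f * b - f0 * b1 - f1 * b" using f(2) b01(1) by (simp add: algebra_simps)
  moreover have "f * b \<in> order_ideal S (Suc d)" using fb f(1) by (auto simp: order_ideal_def)
  moreover have "f0 * b1 \<in> order_ideal S (Suc d)" using order_ideal_mult[OF f(4) b01(3)] by simp
  moreover have "f1 * b \<in> order_ideal S (Suc d)" using order_ideal_mult[OF f(5), of b 0] by simp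
  ultimately have in_Suc: "f0 * b0 \<in> order_ideal S (Suc d)" by (simp add: diff)
  have "f0 * b0 \<noteq> 0" using f(3) b01(2) by simp
  then obtain e where e: "e \<in> Poly_Mapping.keys (f0 * b0)"
    by (metis in_keys_iff lookup_zero poly_mapping_eqI)
  then have "degree_on S e = d"
    using keys_mult[of f0 b0] f(6) b01(4) by (fastforce simp: degree_on_add)
  then show False using in_Suc e by (auto simp: order_ideal_def)
qed

text \<open>Primality is the case \<open>m = 1\<close> of \<open>order_ideal_cancel\<close>.\<close>

lemma primeideal_order_ideal:
  "primeideal (order_ideal S 1 :: ('n::{finite,linorder}, 'k::idom) mpoly set) ring_of_type_algebra"
  unfolding primeideal_ring_of_type_algebra_iff
proof (intro conjI allI impI)
  show "1 \<notin> (order_ideal S 1 :: ('n, 'k) mpoly set)"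
    by (simp add: order_ideal_def degree_on_def)
qed (use ideal_order_ideal order_ideal_cancel in blast)+

text \<open>Peels one variable of \<open>S\<close> off a monomial, which drives the induction in
  \<open>power_mult_order_ideal\<close>.\<close>

lemma degree_on_pos_split:
  assumes "0 < degree_on S e"
  obtains i e' where "i \<in> S" "e = e' + Poly_Mapping.single i 1" "degree_on S e = Suc (degree_on S e')"
proof -
  have "(\<Sum>i\<in>S. Poly_Mapping.lookup e i) \<noteq> 0"
    using assms unfolding degree_on_def by (rule gr_implies_not_zero)
  then obtain i where i: "i \<in> S" "Poly_Mapping.lookup e i \<noteq> 0"
    by (rule sum.not_neutral_contains_not_neutral)
  \<comment> \<open>Subtraction of exponents is truncated, but coordinate \<open>i\<close> is
    positive, so nothing is lost.\<close>
  have e: "e = (e - Poly_Mapping.single i 1) + Poly_Mapping.single i 1"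
    by (rule poly_mapping_eqI) (use i in \<open>auto simp: lookup_add lookup_minus lookup_single when_def\<close>)
  have "degree_on S (Poly_Mapping.single i 1) = 1"
    using i(1) by (simp add: degree_on_def lookup_single when_def)
  then show thesis using that[OF i(1) e] degree_on_add by (metis Suc_eq_plus1 e)
qed

lemma var_mem_order_ideal: "i \<in> S \<Longrightarrow> var i \<in> order_ideal S 1"
  by (simp add: order_ideal_def var_def monom_of_def degree_on_def lookup_single when_def)

lemma single_add_var:
  "Poly_Mapping.single (e + Poly_Mapping.single i 1) c = Poly_Mapping.single e c * var i"
  by (simp add: var_def monom_of_def mult_single)

text \<open>A polynomial is the sum of its terms, and a term of positive degree in \<open>S\<close>
  is a multiple of some variable in \<open>S\<close>.\<close>

lemma Idl_vars_eq_order_ideal: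
  "Idl\<^bsub>ring_of_type_algebra\<^esub> (var ` S) = (order_ideal S 1 :: ('n::finite, 'k::comm_ring_1) mpoly set)"
proof
  interpret ring "ring_of_type_algebra :: ('n, 'k) mpoly ring" ..
  show "Idl\<^bsub>ring_of_type_algebra\<^esub> (var ` S) \<subseteq> (order_ideal S 1 :: ('n, 'k) mpoly set)"
    by (intro genideal_minimal ideal_order_ideal) (auto intro: var_mem_order_ideal[simplified])
  have I: "ideal (Idl\<^bsub>ring_of_type_algebra\<^esub> (var ` S :: ('n, 'k) mpoly set)) ring_of_type_algebra"
    by (rule genideal_ideal) simp
  have vars: "var ` S \<subseteq> Idl\<^bsub>ring_of_type_algebra\<^esub> (var ` S :: ('n, 'k) mpoly set)"
    by (rule genideal_self) simp
  show "(order_ideal S 1 :: ('n, 'k) mpoly set) \<subseteq> Idl\<^bsub>ring_of_type_algebra\<^esub> (var ` S)"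
  proof
    fix f :: "('n, 'k) mpoly" assume f: "f \<in> order_ideal S 1"
    have "Poly_Mapping.single e c \<in> Idl\<^bsub>ring_of_type_algebra\<^esub> (var ` S)" if "0 < degree_on S e" for e and c :: 'k
      using that
      by (rule degree_on_pos_split)
        (use vars in \<open>auto simp: single_add_var[simplified] intro!: ideal_mult_left[OF I]\<close>)
    then have "(\<Sum>e\<in>Poly_Mapping.keys f. Poly_Mapping.single e (Poly_Mapping.lookup f e))
        \<in> Idl\<^bsub>ring_of_type_algebra\<^esub> (var ` S)"
      using f by (intro ideal_sum[OF I]) (auto simp: order_ideal_def Suc_le_eq)
    then show "f \<in> Idl\<^bsub>ring_of_type_algebra\<^esub> (var ` S)" by (simp only: sum_single_keys)
  qed
qed

text \<open>Recovers \<open>S\<close> from its ideal; this turns the incidence matrix into the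
  indicator matrix of the sets \<open>S j\<close>.\<close>

lemma var_mem_order_ideal_iff:
  "(var i :: ('n::finite, 'k::comm_ring_1) mpoly) \<in> order_ideal S 1 \<longleftrightarrow> i \<in> S"
  by (simp add: order_ideal_def var_def monom_of_def degree_on_def lookup_single when_def)

subsection \<open>Symbolic powers of an intersection of variable primes\<close>

text \<open>A term of degree at least \<open>m\<close> in \<open>S\<close> contains \<open>m\<close>
  such variables. Pairing each with one factor \<open>g\<close> gives \<open>m\<close> elements of
  \<open>J\<close>, and what remains of the term is a coefficient; sums follow by linearity.\<close>

lemma power_mult_order_ideal:
  fixes J :: "('n::finite, 'k::comm_ring_1) mpoly set"
  assumes J: "ideal J ring_of_type_algebra" and g: "\<And>h. h \<in> order_ideal S 1 \<Longrightarrow> g * h \<in> J"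
    and f: "f \<in> order_ideal S m"
  shows "f * g ^ m \<in> J [^]\<^bsub>ideals_set ring_of_type_algebra\<^esub> m"
proof -
  note I = ideal_power[OF J]
  have single: "Poly_Mapping.single e c * g ^ m \<in> J [^]\<^bsub>ideals_set ring_of_type_algebra\<^esub> m"
    if "m \<le> degree_on S e" for e c
    using that
  proof (induction m arbitrary: e)
    case 0
    then show ?case by (simp add: nat_pow_def ideals_set_def)
  next
    case (Suc m)
    then obtain i e' where ie: "i \<in> S" "e = e' + Poly_Mapping.single i 1"
        "degree_on S e = Suc (degree_on S e')"
      by (metis degree_on_pos_split Suc_le_lessD not_gr0 not_less_zero)
    then have "Poly_Mapping.single e' c * g ^ m \<in> J [^]\<^bsub>ideals_set ring_of_type_algebra\<^esub> m"
      using Suc by simp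
    moreover have "g * var i \<in> J" using ie(1) g by (simp only: var_mem_order_ideal)
    ultimately have "(Poly_Mapping.single e' c * g ^ m) * (g * var i)
        \<in> J [^]\<^bsub>ideals_set ring_of_type_algebra\<^esub> (Suc m)"
      by (rule mult_mem_ideal_power_Suc)
    moreover have "(Poly_Mapping.single e' c * g ^ m) * (g * var i) = Poly_Mapping.single e c * g ^ Suc m"
      unfolding ie(2) single_add_var by (simp only: power_Suc mult_ac)
    ultimately show ?case by (simp only:)
  qed
  have "(\<Sum>e\<in>Poly_Mapping.keys f. Poly_Mapping.single e (Poly_Mapping.lookup f e)) * g ^ m
      \<in> J [^]\<^bsub>ideals_set ring_of_type_algebra\<^esub> m"
    unfolding sum_distrib_right
    using f by (intro ideal_sum[OF I] single) (auto simp: order_ideal_def)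
  then show ?thesis by (simp only: sum_single_keys)
qed

lemma symbolic_power_Inter_order_ideals:
  fixes S :: "'s::finite \<Rightarrow> 'n::{finite,linorder} set"
  defines "Q \<equiv> (\<lambda>j. order_ideal (S j) 1 :: ('n, 'k::idom) mpoly set)"
  assumes irr: "\<And>j. \<not> (\<Inter>i\<in>-{j}. Q i) \<subseteq> Q j"
  shows "symbolic_power (\<Inter>j. Q j) m = (\<Inter>j. order_ideal (S j) m)"
proof -
  let ?I = "\<Inter>j. Q j"
  let ?pow = "\<lambda>m::nat. ?I [^]\<^bsub>ideals_set ring_of_type_algebra\<^esub> m"
  have prime: "primeideal (Q j) ring_of_type_algebra" for j
    unfolding Q_def by (rule primeideal_order_ideal)
  have Qi: "ideal (Q j) ring_of_type_algebra" for j
    unfolding Q_def by (rule ideal_order_ideal)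
  have I: "ideal ?I ring_of_type_algebra"
    using Qi by (auto simp: ideal_ring_of_type_algebra_iff)
  have sub: "?pow m \<subseteq> order_ideal (S j) m" for j m
  proof (rule ideal_power_subset)
    show "?I \<subseteq> order_ideal (S j) 1" by (auto simp: Q_def)
    show "f * g \<in> order_ideal (S j) (Suc m)"
      if "f \<in> order_ideal (S j) m" "g \<in> order_ideal (S j) 1" for f g :: "('n, 'k) mpoly" and m
      using order_ideal_mult[OF that] by simp
  qed (auto intro: ideal_order_ideal)
  have "extend_contract (Q j) (?pow m) = order_ideal (S j) m" for j
  proof -
    \<comment> \<open>By irredundance. Powers of \<open>g\<close> stay outside the prime
      \<open>Q j\<close>, so \<open>g ^ m\<close> serves as the multiplier \<open>b\<close> in
      \<open>extend_contract_eq\<close>.\<close>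
    obtain g where g: "g \<in> (\<Inter>i\<in>-{j}. Q i)" "g \<notin> Q j" using irr by blast
    have "g * h \<in> ?I" if "h \<in> Q j" for h
    proof
      fix i show "g * h \<in> Q i"
        using g(1) that by (cases "i = j") (auto intro: ideal_mult_left[OF Qi] ideal_mult_right[OF Qi])
    qed
    then have "f * g ^ m \<in> ?pow m" if "f \<in> order_ideal (S j) m" for f
      using power_mult_order_ideal[OF I _ that] unfolding Q_def by blast
    moreover have "g ^ n \<notin> Q j" for n
      using g(2) prime[of j] by (induction n) (auto simp: primeideal_ring_of_type_algebra_iff)
    \<comment> \<open>One inclusion has the witness \<open>g ^ m\<close>; the other cancels an
      arbitrary \<open>b\<close> outside \<open>Q j\<close> by
      \<open>order_ideal_cancel\<close>.\<close>
    ultimately show ?thesis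
      unfolding extend_contract_eq[OF prime ideal_power[OF I]]
      using sub order_ideal_cancel unfolding Q_def by blast
  qed
  then show ?thesis
    unfolding symbolic_power_def Ass_Inter_primes[OF prime irr] by simp
qed

text \<open>The ideal is spanned by monomials, so any monomial of a nonzero element is itself a
  witness. The initial degree thus becomes a minimum over exponent vectors.\<close>

lemma graded_piece_Inter_order_ideals:
  "graded_piece (\<Inter>j. order_ideal (S j) m :: ('n::finite, 'k::comm_ring_1) mpoly set) d \<noteq> {0} \<longleftrightarrow>
    (\<exists>e. monom_degree e = d \<and> (\<forall>j. m \<le> degree_on (S j) e))"
proof
  have "0 \<in> graded_piece (\<Inter>j. order_ideal (S j) m :: ('n, 'k) mpoly set) d"
    by (simp add: graded_piece_def order_ideal_def)
  moreover assume "graded_piece (\<Inter>j. order_ideal (S j) m :: ('n, 'k) mpoly set) d \<noteq> {0}"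
  ultimately obtain f where f: "f \<in> graded_piece (\<Inter>j. order_ideal (S j) m :: ('n, 'k) mpoly set) d" "f \<noteq> 0"
    by blast
  then obtain e where "e \<in> Poly_Mapping.keys f"
    by (metis in_keys_iff lookup_zero poly_mapping_eqI)
  then show "\<exists>e. monom_degree e = d \<and> (\<forall>j. m \<le> degree_on (S j) e)"
    using f by (auto simp: graded_piece_def order_ideal_def)
next
  assume "\<exists>e. monom_degree e = d \<and> (\<forall>j. m \<le> degree_on (S j) e)"
  then obtain e where "monom_degree e = d" "\<forall>j. m \<le> degree_on (S j) e" by auto
  then have "Poly_Mapping.single e 1 \<in> graded_piece (\<Inter>j. order_ideal (S j) m :: ('n, 'k) mpoly set) d"
    by (simp add: graded_piece_def order_ideal_def)
  moreover have "Poly_Mapping.single e (1::'k) \<noteq> 0"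
    by (metis lookup_single_eq lookup_zero zero_neq_one)
  ultimately show "graded_piece (\<Inter>j. order_ideal (S j) m :: ('n, 'k) mpoly set) d \<noteq> {0}" by blast
qed

subsection \<open>Comparison with the linear program\<close>

lemma one_inner_vec: "(1 :: real ^ 'n) \<bullet> y = (\<Sum>i\<in>UNIV. y $ i)"
  by (simp add: inner_vec_def)

lemma lp_feasible_indicator_iff:
  "y \<in> lp_feasible (\<chi> j i. if i \<in> S j then 1 else 0) \<longleftrightarrow> (\<forall>j. 1 \<le> (\<Sum>i\<in>S j. y $ i)) \<and> (\<forall>i. 0 \<le> y $ i)"
proof -
  have "(\<Sum>i\<in>UNIV. (if i \<in> T then 1 else 0) * y $ i) = (\<Sum>i\<in>T. y $ i)" for T
    by (simp add: if_distrib[of "\<lambda>x. x * _"] sum.If_cases)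
  then show ?thesis by (simp add: lp_feasible_def less_eq_vec_def matrix_vector_mult_def)
qed

text \<open>\<open>a m\<close> is the optimum of the integer program with right-hand side
  \<open>m\<close>. Scaling an integer optimum by \<open>1/m\<close> gives the lower bound; rounding
  up \<open>m\<close> times \<open>ystar\<close> gives the upper one.\<close>

lemma min_cover_degree_bounds:
  fixes S :: "'s::finite \<Rightarrow> 'n::finite set" and ystar :: "real ^ 'n"
  defines "F \<equiv> lp_feasible (\<chi> j i. if i \<in> S j then 1 else 0)"
  defines "a \<equiv> (\<lambda>m. LEAST d. \<exists>e. monom_degree e = d \<and> (\<forall>j. m \<le> degree_on (S j) e))"
  assumes feas: "ystar \<in> F" and opt: "\<And>y. y \<in> F \<Longrightarrow> 1 \<bullet> ystar \<le> 1 \<bullet> y" and "m > 0"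
  shows "1 \<bullet> ystar \<le> real (a m) / real m" "real (a m) / real m \<le> 1 \<bullet> ystar + real CARD('n) / real m"
proof -
  have ys: "1 \<le> (\<Sum>i\<in>S j. ystar $ i)" "0 \<le> ystar $ i" for i j
    using feas by (auto simp: F_def lp_feasible_indicator_iff)
  \<comment> \<open>Since \<open>ystar\<close> is nonnegative, \<open>nat\<close> truncates nothing,
    and rounding costs at most 1 in each coordinate.\<close>
  define e0 :: "'n \<Rightarrow>\<^sub>0 nat" where "e0 = Abs_poly_mapping (\<lambda>i. nat \<lceil>real m * ystar $ i\<rceil>)"
  have e0: "Poly_Mapping.lookup e0 i = nat \<lceil>real m * ystar $ i\<rceil>" for i
    by (simp add: e0_def)
  have e0_bounds: "real m * ystar $ i \<le> Poly_Mapping.lookup e0 i"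
    "Poly_Mapping.lookup e0 i \<le> real m * ystar $ i + 1" for i
    unfolding e0 using ys(2)[of i] by (auto intro: real_nat_ceiling_ge)
  have "real m \<le> real (degree_on (S j) e0)" for j
  proof -
    have "real m \<le> real m * (\<Sum>i\<in>S j. ystar $ i)"
      using ys(1)[of j] by (simp add: mult_le_cancel_left1)
    also have "\<dots> \<le> real (degree_on (S j) e0)"
      unfolding degree_on_def sum_distrib_left of_nat_sum by (intro sum_mono e0_bounds)
    finally show ?thesis .
  qed
  then have e0_cover: "\<forall>j. m \<le> degree_on (S j) e0" by simp
  have "real (a m) \<le> real (monom_degree e0)"
    unfolding a_def using e0_cover by (intro of_nat_mono Least_le) auto
  also have "\<dots> \<le> (\<Sum>i\<in>UNIV. real m * ystar $ i + 1)"
    unfolding monom_degree_def of_nat_sum by (intro sum_mono e0_bounds)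
  also have "\<dots> = real m * (1 \<bullet> ystar) + real CARD('n)"
    unfolding one_inner_vec by (simp add: sum.distrib flip: sum_distrib_left)
  finally show "real (a m) / real m \<le> 1 \<bullet> ystar + real CARD('n) / real m"
    using \<open>m > 0\<close> by (simp add: pos_divide_le_eq distrib_left mult.commute)
  \<comment> \<open>The vector \<open>e0\<close> shows that the minimum is over a nonempty set and
    hence attained.\<close>
  have "\<exists>e. monom_degree e = a m \<and> (\<forall>j. m \<le> degree_on (S j) e)"
    unfolding a_def by (rule LeastI_ex) (use e0_cover in auto)
  then obtain e where e: "monom_degree e = a m" "\<And>j. m \<le> degree_on (S j) e" by auto
  define y :: "real ^ 'n" where "y = (\<chi> i. real (Poly_Mapping.lookup e i) / real m)"
  have "(\<Sum>i\<in>S j. y $ i) = real (degree_on (S j) e) / real m" for j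
    by (simp add: y_def degree_on_def sum_divide_distrib)
  then have "y \<in> F"
    using e(2) \<open>m > 0\<close> by (simp add: F_def lp_feasible_indicator_iff y_def)
  then have "1 \<bullet> ystar \<le> 1 \<bullet> y" by (rule opt)
  also have "1 \<bullet> y = real (a m) / real m"
    by (simp add: one_inner_vec y_def e(1)[symmetric] monom_degree_def sum_divide_distrib)
  finally show "1 \<bullet> ystar \<le> real (a m) / real m" .
qed

theorem theorem3p2:
  fixes I :: "('n::{finite,linorder}, 'k::alg_closed_field) mpoly set"
    and P :: "'s::finite \<Rightarrow> ('n, 'k) mpoly set"
    and A :: "real ^ ('n::{finite,linorder}) ^ 's"
    and ystar :: "real ^ ('n::{finite,linorder})"
  assumes "squarefree_monomial_ideal I" and "I \<noteq> {0}" and "I \<noteq> UNIV"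
    and "minimal_primary_decomposition I P"
    and "\<And>j. \<exists>S. P j = Idl\<^bsub>ring_of_type_algebra\<^esub> (var ` S)"
    and "A = incidence_matrix P"
    and "is_arg_min (\<lambda>y. 1 \<bullet> y) (\<lambda>y. y \<in> lp_feasible A) ystar"
  shows "convergent (waldschmidt_seq I)
    \<and> waldschmidt_constant I = 1 \<bullet> ystar
    \<and> waldschmidt_constant I = lp_value A"
proof -
  obtain S where "\<And>j. P j = Idl\<^bsub>ring_of_type_algebra\<^esub> (var ` S j)"
    using assms(5) by metis
  then have P: "P = (\<lambda>j. order_ideal (S j) 1)"
    by (intro ext) (simp only: Idl_vars_eq_order_ideal)
  have A: "A = (\<chi> j i. if i \<in> S j then 1 else 0)"
    by (simp only: assms(6) incidence_matrix_def P var_mem_order_ideal_iff)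
  have I: "I = (\<Inter>j. order_ideal (S j) 1)" and irr: "\<And>j. \<not> (\<Inter>i\<in>-{j}. P i) \<subseteq> P j"
    using assms(4) unfolding minimal_primary_decomposition_def P by blast+
  have sym: "symbolic_power I m = (\<Inter>j. order_ideal (S j) m)" for m
    unfolding I using irr by (intro symbolic_power_Inter_order_ideals) (simp add: P)
  have feas: "ystar \<in> lp_feasible A" and opt: "\<And>y. y \<in> lp_feasible A \<Longrightarrow> 1 \<bullet> ystar \<le> 1 \<bullet> y"
    using assms(7) by (auto simp: is_arg_min_linorder)
  have seq: "waldschmidt_seq I m =
      real (LEAST d. \<exists>e. monom_degree e = d \<and> (\<forall>j. m \<le> degree_on (S j) e)) / real m" for m
    by (simp only: waldschmidt_seq_def initial_degree_def sym graded_piece_Inter_order_ideals)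
  note bounds = min_cover_degree_bounds[OF feas[unfolded A] opt[unfolded A], folded seq]
  \<comment> \<open>The bounds divide by \<open>m\<close>, so the squeeze is stated for positive
    \<open>m\<close> only.\<close>
  have pos: "\<forall>\<^sub>F m in sequentially. 0 < m" by (rule eventually_gt_at_top)
  have lim: "waldschmidt_seq I \<longlonglongrightarrow> 1 \<bullet> ystar"
  proof (rule tendsto_sandwich[OF _ _ tendsto_const])
    show "\<forall>\<^sub>F m in sequentially. 1 \<bullet> ystar \<le> waldschmidt_seq I m"
      using pos by (rule eventually_mono) (rule bounds(1))
    show "\<forall>\<^sub>F m in sequentially. waldschmidt_seq I m \<le> 1 \<bullet> ystar + real CARD('n) / real m"
      using pos by (rule eventually_mono) (rule bounds(2))
    show "(\<lambda>m. 1 \<bullet> ystar + real CARD('n) / real m) \<longlonglongrightarrow> 1 \<bullet> ystar"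
      using tendsto_add[OF tendsto_const lim_const_over_n] by simp
  qed
  have "lp_value A = 1 \<bullet> ystar"
    unfolding lp_value_def by (rule cInf_eq_minimum[OF imageI[OF feas]]) (blast intro: opt)
  then show ?thesis
    unfolding waldschmidt_constant_def using limI[OF lim] convergentI[OF lim] by simp
qed

end
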